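(* Let $p\ge 1$, $a>0$, let $\mathbf{\Sigma}:\mathbf{x}\mapsto\mathbf{\Sigma}_{\mathbf{x}}$ be a mapping from $\mathbb{R}^p$ to the set of real symmetric positive definite $p\times p$ matrices, and let $\alpha:\mathbb{R}^p\to(0,+\infty)$. Let $g(\mathbf{x};t)=c\,t^{-\alpha(\mathbf{x})}$ for $\mathbf{x}\in\mathbb{R}^p$, $t>0$, with $c\neq0$ a constant, and let $M(dt)=2t^{p+3}h(t^2)\mathbf{1}_{[0,+\infty)}(t)\,dt$, where $h$ is the density of the inverse Gamma distribution $\mathcal{IG}(1,a^2)$. Consider $$C^{NS}(\mathbf{x},\mathbf{y})=\pi^{-\frac p2}\left|\frac{\mathbf{\Sigma}_{\mathbf{x}}+\mathbf{\Sigma}_{\mathbf{y}}}{2}\right|^{-\frac12}\int_0^{+\infty}g(\mathbf{x};t)g(\mathbf{y};t)\,t^{-p}\exp\left(-\frac{Q_{\mathbf{x}\mathbf{y}}(\mathbf{x}-\mathbf{y})}{t^2}\right)M(dt).$$ Then the associated correlation function $R^{NS}(\mathbf{x},\mathbf{y})=C^{NS}(\mathbf{x},\mathbf{y})/\sqrt{C^{NS}(\mathbf{x},\mathbf{x})\,C^{NS}(\mathbf{y},\mathbf{y})}$ satisfies, for all $\mathbf{x},\mathbf{y}\in\mathbb{R}^p$, $$R^{NS}(\mathbf{x},\mathbf{y})=\phi_{\mathbf{x}\mathbf{y}}\,\frac{\Gamma(\alpha(\mathbf{x},\mathbf{y}))}{\sqrt{\Gamma(\alpha(\mathbf{x}))\Gamma(\alpha(\mathbf{y}))}}\left(1+\frac{Q_{\mathbf{x}\mathbf{y}}(\mathbf{x}-\mathbf{y})}{a^2}\right)^{-\alpha(\mathbf{x},\mathbf{y})},$$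 where $\alpha(\mathbf{x},\mathbf{y})=(\alpha(\mathbf{x})+\alpha(\mathbf{y}))/2$.
   Context: Here $|A|$ denotes the determinant of a matrix $A$; for $\mathbf{h}\in\mathbb{R}^p$, $Q_{\mathbf{x}\mathbf{y}}(\mathbf{h})=\mathbf{h}^T\left(\frac{\mathbf{\Sigma}_{\mathbf{x}}+\mathbf{\Sigma}_{\mathbf{y}}}{2}\right)^{-1}\mathbf{h}$; and $\phi_{\mathbf{x}\mathbf{y}}=|\mathbf{\Sigma}_{\mathbf{x}}|^{\frac14}|\mathbf{\Sigma}_{\mathbf{y}}|^{\frac14}\left|\frac{\mathbf{\Sigma}_{\mathbf{x}}+\mathbf{\Sigma}_{\mathbf{y}}}{2}\right|^{-\frac12}$. $\mathcal{IG}(\alpha,\beta)$ is the inverse Gamma distribution with shape $\alpha$ and scale $\beta$, so here $h(s)=a^2s^{-2}e^{-a^2/s}$ for $s>0$. *)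

theory Defs
  imports "HOL-Analysis.Analysis"
begin

definition sym_pos_def :: "real^'n^'n \<Rightarrow> bool" where
  "sym_pos_def A \<longleftrightarrow> transpose A = A \<and> (\<forall>v. v \<noteq> 0 \<longrightarrow> v \<bullet> (A *v v) > 0)"

definition mean_matrix :: "('x \<Rightarrow> real^'n^'n) \<Rightarrow> 'x \<Rightarrow> 'x \<Rightarrow> real^'n^'n" where
  "mean_matrix \<Sigma> x y = (1 / 2) *\<^sub>R (\<Sigma> x + \<Sigma> y)"

definition Q_form :: "('x \<Rightarrow> real^'n^'n) \<Rightarrow> 'x \<Rightarrow> 'x \<Rightarrow> real^'n \<Rightarrow> real" where
  "Q_form \<Sigma> x y h = h \<bullet> (matrix_inv (mean_matrix \<Sigma> x y) *v h)"

definition phi_factor :: "('x \<Rightarrow> real^'n^'n) \<Rightarrow> 'x \<Rightarrow> 'x \<Rightarrow> real" where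
  "phi_factor \<Sigma> x y =
     det (\<Sigma> x) powr (1 / 4) * det (\<Sigma> y) powr (1 / 4) * det (mean_matrix \<Sigma> x y) powr (- (1 / 2))"

definition inv_gamma_density :: "real \<Rightarrow> real \<Rightarrow> real \<Rightarrow> real" where
  "inv_gamma_density k b s =
     (if s > 0 then b powr k / Gamma k * s powr (- k - 1) * exp (- b / s) else 0)"

definition mixing_measure :: "nat \<Rightarrow> (real \<Rightarrow> real) \<Rightarrow> real measure" where
  "mixing_measure p h =
     density lborel (\<lambda>t. ennreal (2 * t ^ (p + 3) * h (t\<^sup>2) * indicator {0..} t))"

text \<open>The covariance is integrated over the open half-line since \<open>g x t\<close> is only meaningful
  for \<open>t > 0\<close>; the measures of interest have no atom at 0.\<close>

definition C_NS ::
  "(real^'n \<Rightarrow> real^'n^'n) \<Rightarrow> (real^'n \<Rightarrow> real \<Rightarrow> real) \<Rightarrow> real measure \<Rightarrow> real^'n \<Rightarrow> real^'n \<Rightarrow> real" where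
  "C_NS \<Sigma> g M x y =
     pi powr (- (real CARD('n) / 2)) * det (mean_matrix \<Sigma> x y) powr (- (1 / 2)) *
     (LINT t:{0<..}|M. g x t * g y t * t powr (- real CARD('n)) * exp (- Q_form \<Sigma> x y (x - y) / t\<^sup>2))"

definition correlation :: "('x \<Rightarrow> 'x \<Rightarrow> real) \<Rightarrow> 'x \<Rightarrow> 'x \<Rightarrow> real" where
  "correlation C x y = C x y / sqrt (C x x * C y y)"

end

theory Submission
  imports Defs
begin

text \<open>With \<open>h(t\<^sup>2) = a\<^sup>2 t\<^sup>-\<^sup>4 exp (- a\<^sup>2 / t\<^sup>2)\<close> all powers of \<open>t\<close> depending on \<open>p\<close> cancel, and the
  substitution \<open>u = (q + a\<^sup>2) / t\<^sup>2\<close>, where \<open>q\<close> is the quadratic form, turns the integral into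
  Euler's integral for \<open>\<Gamma>(k)\<close> times \<open>(q + a\<^sup>2)\<^sup>-\<^sup>k\<close> with \<open>k\<close> the mean of the two exponents.
  On normalising, the constants cancel and the powers of \<open>a\<close> turn \<open>q + a\<^sup>2\<close> into \<open>1 + q / a\<^sup>2\<close>.\<close>

lemma sym_pos_def_invertible:
  fixes A :: "real^'n^'n"
  assumes "sym_pos_def A"
  shows "invertible A"
proof -
  have "v = 0" if "A *v v = 0" for v
    using assms that by (force simp: sym_pos_def_def)
  then show ?thesis
    by (simp add: invertible_left_inverse matrix_left_invertible_ker)
qed

lemma sym_pos_def_mean_matrix:
  fixes \<Sigma> :: "'x \<Rightarrow> real^'n^'n"
  assumes "sym_pos_def (\<Sigma> x)" "sym_pos_def (\<Sigma> y)"
  shows "sym_pos_def (mean_matrix \<Sigma> x y)"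
  unfolding sym_pos_def_def
proof (intro conjI allI impI)
  show "transpose (mean_matrix \<Sigma> x y) = mean_matrix \<Sigma> x y"
    using assms by (simp add: sym_pos_def_def mean_matrix_def transpose_def vec_eq_iff)
next
  fix v :: "real^'n" assume "v \<noteq> 0"
  then have "v \<bullet> (\<Sigma> x *v v) > 0" "v \<bullet> (\<Sigma> y *v v) > 0"
    using assms by (auto simp: sym_pos_def_def)
  then show "v \<bullet> (mean_matrix \<Sigma> x y *v v) > 0"
    by (simp add: mean_matrix_def scaleR_matrix_vector_assoc [symmetric]
        matrix_vector_mult_add_rdistrib inner_add_right)
qed

text \<open>Writing \<open>h = A *v v\<close> turns the form of the inverse into
  \<open>v \<bullet> (A *v v)\<close>. This keeps \<open>q + a\<^sup>2\<close> positive, as the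
  Gamma integral requires.\<close>

lemma inner_matrix_inv_nonneg:
  fixes A :: "real^'n^'n"
  assumes "sym_pos_def A"
  shows "h \<bullet> (matrix_inv A *v h) \<ge> 0"
proof -
  define v where "v = matrix_inv A *v h"
  \<comment> \<open>\<open>matrix_inv\<close> is a choice term, so its defining equation comes from
    the existence of an inverse.\<close>
  have "A ** matrix_inv A = mat 1"
    using someI_ex [OF sym_pos_def_invertible [OF assms, unfolded invertible_def]]
    by (simp add: matrix_inv_def)
  then have "A *v v = h"
    by (simp add: v_def matrix_vector_mul_assoc)
  moreover have "v \<bullet> (A *v v) \<ge> 0"
    using assms by (cases "v = 0") (auto simp: sym_pos_def_def less_imp_le)
  ultimately show ?thesis
    by (simp add: v_def inner_commute)
qed

text \<open>Euler's integral is pulled back along the decreasing bijection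
  \<open>t \<mapsto> b / t\<^sup>2\<close> of the open half-line, so a single change of variables
  gives both integrability and value.\<close>

lemma Gamma_integral_inverse_square:
  fixes k b :: real
  assumes k: "k > 0" and b: "b > 0"
  defines "f \<equiv> \<lambda>t. 2 * t powr (- 2 * k - 1) * exp (- b / t\<^sup>2)"
  shows "f absolutely_integrable_on {0<..}"
    and "integral {0<..} f = Gamma k * b powr (- k)"
proof -
  define G where "G = (\<lambda>u::real. u powr (k - 1) / exp u)"
  have "(G has_integral Gamma k) {0..}"
    unfolding G_def using k by (rule Gamma_integral_real)
  \<comment> \<open>Dropping the null set \<open>{0}\<close> makes the domain equal to the image of
    \<open>s\<close>.\<close>
  then have G: "(G has_integral Gamma k) {0<..}"
    by (subst has_integral_spike_set_eq [where T = "{0..}"])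
      (auto intro: negligible_subset [of "{0}"])
  then have Gabs: "G absolutely_integrable_on {0<..}"
    by (intro nonnegative_absolutely_integrable_1) (auto simp: G_def has_integral_integrable)
  define s where "s = (\<lambda>t::real. b / t\<^sup>2)"
  have image: "s ` {0<..} = {0<..}"
  proof
    show "{0<..} \<subseteq> s ` {0<..}"
    proof
      fix u :: real assume "u \<in> {0<..}"
      then have "u = s (sqrt (b / u))" "sqrt (b / u) \<in> {0<..}"
        using b by (auto simp: s_def)
      then show "u \<in> s ` {0<..}" by blast
    qed
  qed (use b in \<open>auto simp: s_def\<close>)
  have inj: "inj_on s {0<..}"
    using b by (auto simp: inj_on_def s_def)
  have deriv: "(s has_real_derivative (- 2 * b / t ^ 3)) (at t within {0<..})" if "t \<in> {0<..}" for t
    unfolding s_def using that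
    by (auto intro!: derivative_eq_intros simp: field_simps power2_eq_square power3_eq_cube)
  \<comment> \<open>The Jacobian contributes \<open>t\<close> to the power -3 and
    \<open>G (s t)\<close> the power -2(k - 1), in total -2k - 1; likewise
    \<open>b * b powr (k - 1) = b powr k\<close>.\<close>
  have integrand: "\<bar>- 2 * b / t ^ 3\<bar> *\<^sub>R G (s t) = b powr k * f t" if "t \<in> {0<..}" for t
  proof -
    have t: "t > 0" using that by simp
    have "t powr (2 * (k - 1)) = (t\<^sup>2) powr (k - 1)"
      using t by (simp add: powr_powr flip: powr_numeral)
    moreover have "b powr k = b * b powr (k - 1)"
      using b by (simp add: powr_diff)
    moreover have "t powr (- 2 * k - 1) = 1 / (t ^ 3 * t powr (2 * (k - 1)))"
    proof -
      have "t powr (- 2 * k - 1) * (t powr 3 * t powr (2 * (k - 1))) = 1"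
        using t by (simp add: algebra_simps del: powr_numeral flip: powr_add)
      then show ?thesis using t by (simp add: field_simps)
    qed
    ultimately show ?thesis
      using t b by (simp add: f_def G_def s_def powr_divide exp_minus field_simps)
  qed
  have *: "(\<lambda>t. \<bar>- 2 * b / t ^ 3\<bar> *\<^sub>R G (s t)) absolutely_integrable_on {0<..} \<and>
      integral {0<..} (\<lambda>t. \<bar>- 2 * b / t ^ 3\<bar> *\<^sub>R G (s t)) = Gamma k"
    using has_absolute_integral_change_of_variables_1' [of "{0<..}" s "\<lambda>t. - 2 * b / t ^ 3" G "Gamma k"]
      deriv inj image Gabs G by (auto simp: integral_unique)
  have abs: "(\<lambda>t. b powr k * f t) absolutely_integrable_on {0<..}"
    using conjunct1 [OF *] integrand by (subst set_integrable_cong [OF refl refl integrand [symmetric]])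
  have int: "integral {0<..} (\<lambda>t. b powr k * f t) = Gamma k"
    using conjunct2 [OF *] by (subst integral_cong [OF integrand [symmetric]])
  from abs show "f absolutely_integrable_on {0<..}"
    using b by simp
  from int show "integral {0<..} f = Gamma k * b powr (- k)"
    using b by (simp add: powr_minus field_simps)
qed

text \<open>The two exponentials merge into one with parameter \<open>q + b\<close>, and the
  remaining powers of \<open>t\<close> combine to the exponent -2k - 1 of the previous
  lemma.\<close>

lemma integral_mixing_measure:
  fixes k b c q :: real and p :: nat
  assumes k: "k > 0" and b: "b > 0" and q: "q \<ge> 0"
  shows "(LINT t:{0<..}|mixing_measure p (inv_gamma_density 1 b).
      c * t powr (- 2 * k) * t powr (- real p) * exp (- q / t\<^sup>2)) =
    c * b * Gamma k * (q + b) powr (- k)"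
proof -
  define w where "w t = 2 * t ^ (p + 3) * inv_gamma_density 1 b (t\<^sup>2) * indicator {0..} t" for t
  have w: "w \<in> borel_measurable lborel"
    unfolding w_def inv_gamma_density_def by measurable
  \<comment> \<open>Nonnegativity ensures that \<open>ennreal\<close> truncates nothing, so the
    density becomes a plain factor of the integrand.\<close>
  have "w t \<ge> 0" for t
    using b by (auto simp: w_def inv_gamma_density_def indicator_def)
  then have "(LINT t:{0<..}|mixing_measure p (inv_gamma_density 1 b).
      c * t powr (- 2 * k) * t powr (- real p) * exp (- q / t\<^sup>2)) =
    (LINT t|lborel. w t *\<^sub>R (indicator {0<..} t *\<^sub>R 
        (c * t powr (- 2 * k) * t powr (- real p) * exp (- q / t\<^sup>2))))"
    unfolding mixing_measure_def set_lebesgue_integral_def w_def [symmetric]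
    using w by (intro integral_density) auto
  also have "\<dots> = (LINT t:{0<..}|lborel. c * b * (2 * t powr (- 2 * k - 1) * exp (- (q + b) / t\<^sup>2)))"
    unfolding set_lebesgue_integral_def
  proof (rule Bochner_Integration.integral_cong)
    fix t :: real
    show "w t *\<^sub>R (indicator {0<..} t *\<^sub>R
        (c * t powr (- 2 * k) * t powr (- real p) * exp (- q / t\<^sup>2))) =
      indicator {0<..} t *\<^sub>R (c * b * (2 * t powr (- 2 * k - 1) * exp (- (q + b) / t\<^sup>2)))"
    proof (cases "t > 0")
      case True
      \<comment> \<open>The exponent -2 is the \<open>- k - 1\<close> of the inverse Gamma density
        at shape 1; against \<open>t ^ (p + 3)\<close> it leaves
        \<open>t powr (real p - 1)\<close>.\<close>
      have "(t\<^sup>2) powr (- 2) = t powr (- 4)"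
        using True by (simp add: powr_powr flip: powr_numeral)
      moreover have "t ^ (p + 3) = t powr (real p + 3)"
        using True by (simp flip: powr_realpow)
      ultimately have "w t = 2 * b * t powr (real p - 1) * exp (- b / t\<^sup>2)"
        using True b by (simp add: w_def inv_gamma_density_def flip: powr_add)
      moreover have "exp (- (q + b) / t\<^sup>2) = exp (- q / t\<^sup>2) * exp (- b / t\<^sup>2)"
        by (simp add: add_divide_distrib diff_divide_distrib flip: exp_add)
      moreover have "- 2 * k - 1 = (real p - 1) + (- 2 * k) + (- real p)"
        by simp
      then have "t powr (- 2 * k - 1) = t powr (real p - 1) * t powr (- 2 * k) * t powr (- real p)"
        by (simp only: powr_add)
      ultimately show ?thesis using True by simp
    qed simp
  qed simp
  also have "\<dots> = c * b * (LINT t:{0<..}|lborel. 2 * t powr (- 2 * k - 1) * exp (- (q + b) / t\<^sup>2))"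
    by (rule set_integral_mult_right)
  \<comment> \<open>Gauge integrals agree with Lebesgue integrals over the completed measure;
    completion does not change the integral of a Borel function.\<close>
  also have "(LINT t:{0<..}|lborel. 2 * t powr (- 2 * k - 1) * exp (- (q + b) / t\<^sup>2)) =
      (LINT t:{0<..}|lebesgue. 2 * t powr (- 2 * k - 1) * exp (- (q + b) / t\<^sup>2))"
    unfolding set_lebesgue_integral_def by (subst integral_completion) auto
  also have "\<dots> = Gamma k * (q + b) powr (- k)"
    using Gamma_integral_inverse_square [of k "q + b"] k b q
    by (simp add: set_lebesgue_integral_eq_integral)
  finally show ?thesis by simp
qed

lemma C_NS_power_inv_gamma:
  fixes \<Sigma> :: "real^'p \<Rightarrow> real^'p^'p"
  assumes "a > 0" "sym_pos_def (\<Sigma> x)" "sym_pos_def (\<Sigma> y)" "\<alpha> x > 0" "\<alpha> y > 0"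
    and g: "\<And>x t. t > 0 \<Longrightarrow> g x t = c * t powr (- \<alpha> x)"
  shows "C_NS \<Sigma> g (mixing_measure CARD('p) (inv_gamma_density 1 (a\<^sup>2))) x y =
     pi powr (- (real CARD('p) / 2)) * c\<^sup>2 * a\<^sup>2 * det (mean_matrix \<Sigma> x y) powr (- (1 / 2)) *
     Gamma ((\<alpha> x + \<alpha> y) / 2) *
     (Q_form \<Sigma> x y (x - y) + a\<^sup>2) powr (- ((\<alpha> x + \<alpha> y) / 2))"
proof -
  define M where "M = mixing_measure CARD('p) (inv_gamma_density 1 (a\<^sup>2))"
  define q where "q = Q_form \<Sigma> x y (x - y)"
  have q: "q \<ge> 0"
    unfolding q_def Q_form_def
    by (intro inner_matrix_inv_nonneg sym_pos_def_mean_matrix assms)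
  have "(LINT t:{0<..}|M. g x t * g y t * t powr (- real CARD('p)) * exp (- q / t\<^sup>2)) =
    (LINT t:{0<..}|M. c\<^sup>2 * t powr (- 2 * ((\<alpha> x + \<alpha> y) / 2)) * t powr (- real CARD('p)) * exp (- q / t\<^sup>2))"
  \<comment> \<open>\<open>g\<close> is prescribed only for \<open>t > 0\<close>, so it is replaced
    inside the set integral; the exponent is written as -2 times a mean to match
    \<open>k\<close>.\<close>
  proof (rule set_lebesgue_integral_cong)
    show "{0<..} \<in> sets M" by (simp add: M_def mixing_measure_def)
    have "g x t * g y t = c\<^sup>2 * t powr (- 2 * ((\<alpha> x + \<alpha> y) / 2))" if "t > 0" for t
    proof -
      have "- 2 * ((\<alpha> x + \<alpha> y) / 2) = - \<alpha> x + - \<alpha> y"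
        by simp
      then have "t powr (- 2 * ((\<alpha> x + \<alpha> y) / 2)) = t powr (- \<alpha> x) * t powr (- \<alpha> y)"
        by (simp only: powr_add)
      then show ?thesis by (simp add: g that power2_eq_square)
    qed
    then show "\<forall>t. t \<in> {0<..} \<longrightarrow> g x t * g y t * t powr (- real CARD('p)) * exp (- q / t\<^sup>2) =
        c\<^sup>2 * t powr (- 2 * ((\<alpha> x + \<alpha> y) / 2)) * t powr (- real CARD('p)) * exp (- q / t\<^sup>2)"
      by simp
  qed
  also have "\<dots> = c\<^sup>2 * a\<^sup>2 * Gamma ((\<alpha> x + \<alpha> y) / 2) * (q + a\<^sup>2) powr (- ((\<alpha> x + \<alpha> y) / 2))"
    unfolding M_def using assms q by (intro integral_mixing_measure) auto
  finally show ?thesis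
    by (simp add: C_NS_def M_def q_def)
qed

theorem corollary3p5:
  fixes \<Sigma> :: "real^'p \<Rightarrow> real^'p^'p"
    and \<alpha> :: "real^'p \<Rightarrow> real"
    and g :: "real^'p \<Rightarrow> real \<Rightarrow> real"
    and a c :: real
    and M :: "real measure"
  assumes "a > 0"
    and "\<And>x. sym_pos_def (\<Sigma> x)"
    and "\<And>x. \<alpha> x > 0"
    and "c \<noteq> 0"
    and "\<And>x t. t > 0 \<Longrightarrow> g x t = c * t powr (- \<alpha> x)"
    and "M = mixing_measure CARD('p) (inv_gamma_density 1 (a\<^sup>2))"
  shows "\<forall>x y. correlation (C_NS \<Sigma> g M) x y =
     phi_factor \<Sigma> x y *
     (Gamma ((\<alpha> x + \<alpha> y) / 2) / sqrt (Gamma (\<alpha> x) * Gamma (\<alpha> y))) *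
     (1 + Q_form \<Sigma> x y (x - y) / a\<^sup>2) powr (- ((\<alpha> x + \<alpha> y) / 2))"
proof (intro allI)
  fix x y
  define K where "K = pi powr (- (real CARD('p) / 2)) * c\<^sup>2 * a\<^sup>2"
  define k where "k = (\<alpha> x + \<alpha> y) / 2"
  define q where "q = Q_form \<Sigma> x y (x - y)"
  define D where "D = det (mean_matrix \<Sigma> x y) powr (- (1 / 2))"
  have C: "C_NS \<Sigma> g M u v = K * det (mean_matrix \<Sigma> u v) powr (- (1 / 2)) *
     Gamma ((\<alpha> u + \<alpha> v) / 2) *
     (Q_form \<Sigma> u v (u - v) + a\<^sup>2) powr (- ((\<alpha> u + \<alpha> v) / 2))" for u v
    unfolding assms(6) K_def by (rule C_NS_power_inv_gamma) (use assms in auto)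
  \<comment> \<open>On the diagonal the mean matrix is \<open>\<Sigma> u\<close> itself and the
    quadratic form is evaluated at 0.\<close>
  have diag: "C_NS \<Sigma> g M u u = K * det (\<Sigma> u) powr (- (1 / 2)) * Gamma (\<alpha> u) * (a\<^sup>2) powr (- \<alpha> u)" for u
    unfolding C by (simp add: mean_matrix_def Q_form_def flip: scaleR_2)
  have K: "K > 0" using assms by (simp add: K_def)
  \<comment> \<open>Nonvanishing is enough: every power of a nonzero real is positive, as \<open>x powr r = exp (r * ln x)\<close>.\<close>
  have nz: "det (\<Sigma> u) \<noteq> 0" for u
    using assms sym_pos_def_invertible invertible_det_nz by blast
  have q: "q \<ge> 0"
    unfolding q_def Q_form_def
    by (intro inner_matrix_inv_nonneg sym_pos_def_mean_matrix assms)
  have Gpos: "Gamma (\<alpha> u) > 0" for u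
    using assms by (simp add: Gamma_real_pos)
  have sqrt_powr: "sqrt (z powr r) = z powr (r / 2)" for z r :: real
    by (simp add: powr_powr flip: powr_half_sqrt)
  have "sqrt (C_NS \<Sigma> g M x x * C_NS \<Sigma> g M y y) =
      K * (det (\<Sigma> x) powr (- (1 / 4)) * det (\<Sigma> y) powr (- (1 / 4))) *
      sqrt (Gamma (\<alpha> x) * Gamma (\<alpha> y)) * (a\<^sup>2) powr (- k)"
  proof -
    \<comment> \<open>The root halves both variance exponents, whose sum is then the exponent
      \<open>- k\<close> of the cross-covariance.\<close>
    have "(a\<^sup>2) powr (- k) = (a\<^sup>2) powr (- \<alpha> x / 2) * (a\<^sup>2) powr (- \<alpha> y / 2)"
      by (simp add: k_def add_divide_distrib flip: powr_add)
    then show ?thesis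
      using K unfolding diag by (simp add: real_sqrt_mult sqrt_powr)
  qed
  moreover have "1 + q / a\<^sup>2 = (q + a\<^sup>2) / a\<^sup>2"
    using assms(1) by (simp add: field_simps)
  then have "(1 + q / a\<^sup>2) powr (- k) = (q + a\<^sup>2) powr (- k) / (a\<^sup>2) powr (- k)"
    using q by (simp add: powr_divide)
  \<comment> \<open>The quarter powers in \<open>phi_factor\<close> are the reciprocals of the
    determinant factors left by the root of the variances.\<close>
  moreover have "phi_factor \<Sigma> x y = D / (det (\<Sigma> x) powr (- (1 / 4)) * det (\<Sigma> y) powr (- (1 / 4)))"
    using nz by (simp add: phi_factor_def D_def powr_minus field_simps)
  moreover have "C_NS \<Sigma> g M x y = K * D * Gamma k * (q + a\<^sup>2) powr (- k)"
    by (simp add: C D_def k_def q_def)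
  ultimately show "correlation (C_NS \<Sigma> g M) x y =
     phi_factor \<Sigma> x y *
     (Gamma ((\<alpha> x + \<alpha> y) / 2) / sqrt (Gamma (\<alpha> x) * Gamma (\<alpha> y))) *
     (1 + Q_form \<Sigma> x y (x - y) / a\<^sup>2) powr (- ((\<alpha> x + \<alpha> y) / 2))"
    using K by (simp add: correlation_def flip: k_def q_def)
qed

end
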